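(* $(E^m_{nc},H_{\rm end})$ is the completion of $(E^m,H_{\rm end})$; that is, $(E^m_{nc},H_{\rm end})$ is a complete metric space containing $E^m$ as a dense subset.
   Context: A fuzzy set on $\mathbb{R}^m$ is a function $u:\mathbb{R}^m\to[0,1]$. For $\alpha\in(0,1]$, $[u]_\alpha=\{x:u(x)\ge\alpha\}$, and $[u]_0=\overline{\{x:u(x)>0\}}$. $E^m_{nc}$ (noncompact fuzzy numbers) is the set of all fuzzy sets $u$ on $\mathbb{R}^m$ such that: $u$ is upper semi-continuous; $u$ is normal, i.e. $u(x_0)=1$ for some $x_0$; $u$ is fuzzy convex, i.e. $u(\lambda x+(1-\lambda)y)\ge\min\{u(x),u(y)\}$ for all $x,y\in\mathbb{R}^m$ and $\lambda\in[0,1]$; and $[u]_\alpha$ is bounded for each $\alpha\in(0,1]$. $E^m$ (fuzzy numbers) is the set of those fuzzy sets satisfying the first three of these conditions and with $[u]_0$ bounded. The endograph of $u$ is ${\rm end}\,u=\{(x,t)\in\mathbb{R}^m\times[0,1]:u(x)\ge t\}$, and the endograph metric is $H_{\rm end}(u,v)=H({\rm end}\,u,{\rm end}\,v)$, where $H(A,B)=\max\{\sup_{a\in A}\inf_{b\in B}d(a,b),\ \sup_{b\in B}\inf_{a\in A}d(a,b)\}$ is the Hausdorff metric on nonempty closed sets ($d$ Euclidean). *)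

theory Defs
  imports "HOL-Analysis.Analysis"
begin

definition fuzzy_set :: "(real ^ 'm \<Rightarrow> real) \<Rightarrow> bool" where
  "fuzzy_set u \<longleftrightarrow> (\<forall>x. 0 \<le> u x \<and> u x \<le> 1)"

definition level_set :: "(real ^ 'm \<Rightarrow> real) \<Rightarrow> real \<Rightarrow> (real ^ 'm) set" where
  "level_set u \<alpha> = (if \<alpha> = 0 then closure {x. u x > 0} else {x. u x \<ge> \<alpha>})"

definition upper_semicontinuous :: "('a::topological_space \<Rightarrow> real) \<Rightarrow> bool" where
  "upper_semicontinuous u \<longleftrightarrow> (\<forall>x. \<forall>c > u x. \<forall>\<^sub>F y in nhds x. u y < c)"

definition normal_fuzzy :: "(real ^ 'm \<Rightarrow> real) \<Rightarrow> bool" where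
  "normal_fuzzy u \<longleftrightarrow> (\<exists>x. u x = 1)"

definition fuzzy_convex :: "(real ^ 'm \<Rightarrow> real) \<Rightarrow> bool" where
  "fuzzy_convex u \<longleftrightarrow>
     (\<forall>x y. \<forall>l\<in>{0..1}. u (l *\<^sub>R x + (1 - l) *\<^sub>R y) \<ge> min (u x) (u y))"

definition noncompact_fuzzy_numbers :: "(real ^ 'm \<Rightarrow> real) set" where
  "noncompact_fuzzy_numbers = {u. fuzzy_set u \<and> upper_semicontinuous u \<and> normal_fuzzy u \<and>
     fuzzy_convex u \<and> (\<forall>\<alpha>\<in>{0<..1}. bounded (level_set u \<alpha>))}"

definition fuzzy_numbers :: "(real ^ 'm \<Rightarrow> real) set" where
  "fuzzy_numbers = {u. fuzzy_set u \<and> upper_semicontinuous u \<and> normal_fuzzy u \<and>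
     fuzzy_convex u \<and> bounded (level_set u 0)}"

definition endograph :: "(real ^ 'm \<Rightarrow> real) \<Rightarrow> ((real ^ 'm) \<times> real) set" where
  "endograph u = {(x, t). 0 \<le> t \<and> t \<le> 1 \<and> u x \<ge> t}"

text \<open>The suprema and infima are taken in \<open>[0, \<infinity>]\<close>, where they always exist.\<close>

definition hausdorff_distance :: "'a::metric_space set \<Rightarrow> 'a set \<Rightarrow> ennreal" where
  "hausdorff_distance A B =
     max (SUP a\<in>A. INF b\<in>B. ennreal (dist a b)) (SUP b\<in>B. INF a\<in>A. ennreal (dist a b))"

text \<open>The metric on the product type \<open>(real ^ 'm) \<times> real\<close> is the Euclidean one. The conversion to a
  real number is harmless: between fuzzy sets the Hausdorff distance of endographs is at most 1,
  as the lemma below records. The library's locale for metric spaces requires nonnegativity and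
  symmetry of the distance outside the carrier as well; this definition has both for arbitrary
  arguments.\<close>

definition endograph_metric :: "(real ^ 'm \<Rightarrow> real) \<Rightarrow> (real ^ 'm \<Rightarrow> real) \<Rightarrow> real" where
  "endograph_metric u v = enn2real (hausdorff_distance (endograph u) (endograph v))"

lemma hausdorff_distance_endograph_le_1:
  fixes u v :: "real ^ 'm \<Rightarrow> real"
  assumes "fuzzy_set u" "fuzzy_set v"
  shows "hausdorff_distance (endograph u) (endograph v) \<le> 1"
proof -
  have dir: "(INF b\<in>endograph w. ennreal (dist a b)) \<le> 1"
    if "a \<in> endograph z" "fuzzy_set w" for w z :: "real ^ 'm \<Rightarrow> real" and a
  proof -
    have "(fst a, 0) \<in> endograph w" and "dist a (fst a, 0) \<le> 1"
      using that by (auto simp: endograph_def fuzzy_set_def dist_prod_def)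
    then show ?thesis
      by (metis INF_lower2 ennreal_leI ennreal_1)
  qed
  show ?thesis
    unfolding hausdorff_distance_def
    using dir[of _ u v] dir[of _ v u] assms by (auto intro!: SUP_least simp: dist_commute)
qed

end

theory Submission
  imports Defs
begin

text \<open>
  Everything is read off from endographs. A fuzzy set is recovered from its endograph, and the
  subsets of \<open>(real ^ 'm) \<times> [0, 1]\<close> that arise as endographs of upper semicontinuous fuzzy sets are
  exactly the closed ones that contain the floor \<open>t = 0\<close> and are closed under lowering \<open>t\<close>
  (\<open>endograph_of_closed_hypograph\<close>, \<open>upper_semicontinuous_iff_closed_endograph\<close>). So upper
  semicontinuity gives \<open>u = v\<close> from distance zero, and the triangle inequality is the usual one for
  Hausdorff distances.

  For completeness, let \<open>\<sigma>\<close> be a Cauchy sequence and let \<open>E\<close> be the set of points approached by the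
  endographs of \<open>\<sigma> n\<close> (the lower Kuratowski limit). It is the endograph of an upper
  semicontinuous fuzzy set \<open>u\<close>. Every point of \<open>E\<close> is uniformly close to the late endographs by the
  Cauchy property. Conversely, a point of a late endograph has companions nearby in all later
  endographs; closed balls of the Euclidean space are compact, so these companions accumulate at
  some point, and the Cauchy property puts that point in \<open>E\<close>. Hence \<open>\<sigma>\<close> converges to \<open>u\<close>. The
  limit inherits the remaining properties (\<open>limit_in_noncompact_fuzzy_numbers\<close>): a level set of
  \<open>u\<close> at height \<open>\<alpha>\<close> lies near a level set of some \<open>\<sigma> n\<close> at height \<open>\<alpha>/2\<close>, hence is bounded; this
  boundedness keeps points of height nearly 1 from escaping to infinity, which gives normality;
  and convexity passes through approximation because the endograph is closed.

  For density, \<open>u\<close> is replaced by 0 wherever it is below \<open>\<epsilon>\<close>. This moves the endograph by at most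
  \<open>\<epsilon>\<close>, and the support of the result is contained in the bounded level set of \<open>u\<close> at \<open>\<epsilon>\<close>.
\<close>

section \<open>The endograph metric in terms of points\<close>

lemma endograph_metric_nonneg: "0 \<le> endograph_metric u v"
  by (simp add: endograph_metric_def)

lemma endograph_metric_lessD:
  fixes u v :: "real ^ 'm \<Rightarrow> real"
  assumes "fuzzy_set u" "fuzzy_set v" "endograph_metric u v < e" "p \<in> endograph u"
  shows "\<exists>q\<in>endograph v. dist p q < e"
proof -
  let ?h = "hausdorff_distance (endograph u) (endograph v)"
  have "?h \<le> 1" using hausdorff_distance_endograph_le_1 assms by blast
  then have "?h < top" using ennreal_one_less_top le_less_trans by blast
  then have "?h = ennreal (endograph_metric u v)"
    by (simp add: endograph_metric_def)
  then have h: "?h < ennreal e"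
    using assms(3) ennreal_less_iff[OF endograph_metric_nonneg] by metis
  have "(INF q\<in>endograph v. ennreal (dist p q)) \<le> ?h"
    unfolding hausdorff_distance_def using assms(4) by (intro max.coboundedI1 SUP_upper)
  then have "(INF q\<in>endograph v. ennreal (dist p q)) < ennreal e" using h by order
  then show ?thesis by (auto simp: INF_less_iff ennreal_less_iff)
qed

lemma endograph_metric_leI:
  assumes "0 \<le> e"
    and "\<And>p. p \<in> endograph u \<Longrightarrow> \<exists>q\<in>endograph v. dist p q \<le> e"
    and "\<And>p. p \<in> endograph v \<Longrightarrow> \<exists>q\<in>endograph u. dist p q \<le> e"
  shows "endograph_metric u v \<le> e"
proof -
  have "(INF q\<in>endograph v. ennreal (dist p q)) \<le> ennreal e" if "p \<in> endograph u" for p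
    using assms(2)[OF that] by (meson INF_lower2 ennreal_leI)
  moreover have "(INF q\<in>endograph u. ennreal (dist q p)) \<le> ennreal e" if "p \<in> endograph v" for p
    using assms(3)[OF that] by (metis INF_lower2 dist_commute ennreal_leI)
  ultimately have "hausdorff_distance (endograph u) (endograph v) \<le> ennreal e"
    unfolding hausdorff_distance_def by (auto intro!: SUP_least)
  then show ?thesis
    unfolding endograph_metric_def using assms(1) by (simp add: enn2real_leI)
qed

lemma endograph_metric_commute: "endograph_metric u v = endograph_metric v u"
  by (simp add: endograph_metric_def hausdorff_distance_def max.commute dist_commute)

lemma endograph_metric_triangle:
  fixes u v w :: "real ^ 'm \<Rightarrow> real"
  assumes "fuzzy_set u" "fuzzy_set v" "fuzzy_set w"
  shows "endograph_metric u w \<le> endograph_metric u v + endograph_metric v w"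
proof (rule field_le_epsilon)
  fix e :: real assume "0 < e"
  let ?a = "endograph_metric u v + e/2" and ?b = "endograph_metric v w + e/2"
  \<comment> \<open>The infima need not be attained, so each of the two steps gets a slack of \<open>e/2\<close>.\<close>
  have path: "\<exists>r\<in>endograph z. dist p r \<le> a + b"
    if h: "fuzzy_set x" "fuzzy_set y" "fuzzy_set z" "endograph_metric x y < a"
      "endograph_metric y z < b" "p \<in> endograph x" for x y z :: "real ^ 'm \<Rightarrow> real" and a b p
  proof -
    obtain q where q: "q \<in> endograph y" "dist p q < a"
      using endograph_metric_lessD[OF h(1,2,4,6)] by blast
    obtain r where "r \<in> endograph z" "dist q r < b"
      using endograph_metric_lessD[OF h(2,3,5) q(1)] by blast
    with q show ?thesis using dist_triangle[of p r q] by force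
  qed
  have "endograph_metric u w \<le> ?a + ?b"
  proof (rule endograph_metric_leI)
    show "0 \<le> ?a + ?b"
      using \<open>0 < e\<close> endograph_metric_nonneg[of u v] endograph_metric_nonneg[of v w] by simp
    show "\<exists>q\<in>endograph w. dist p q \<le> ?a + ?b" if "p \<in> endograph u" for p
      using path[of u v w ?a ?b p] that assms \<open>0 < e\<close> by simp
    show "\<exists>q\<in>endograph u. dist p q \<le> ?a + ?b" if "p \<in> endograph w" for p
      using path[of w v u ?b ?a p] that assms \<open>0 < e\<close>
      by (simp add: endograph_metric_commute add.commute)
  qed
  then show "endograph_metric u w \<le> endograph_metric u v + endograph_metric v w + e" by simp
qed

section \<open>Endographs of upper semicontinuous fuzzy sets\<close>

lemma endograph_iff: "fuzzy_set u \<Longrightarrow> (x, t) \<in> endograph u \<longleftrightarrow> 0 \<le> t \<and> t \<le> u x"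
  unfolding endograph_def fuzzy_set_def by (auto intro: order_trans)

lemma closed_level:
  assumes "closed (endograph u)" "0 \<le> c" "c \<le> 1"
  shows "closed {x. c \<le> u x}"
proof -
  have "closed ((\<lambda>x. (x, c)) -` endograph u)"
    by (intro closed_vimage assms continuous_intros)
  moreover have "(\<lambda>x. (x, c)) -` endograph u = {x. c \<le> u x}"
    using assms by (auto simp: endograph_def)
  ultimately show ?thesis by simp
qed

lemma upper_semicontinuous_iff_closed_endograph:
  fixes u :: "real ^ 'm \<Rightarrow> real"
  assumes "fuzzy_set u"
  shows "upper_semicontinuous u \<longleftrightarrow> closed (endograph u)"
proof
  assume usc: "upper_semicontinuous u"
  show "closed (endograph u)"
    unfolding closed_sequential_limits
  proof (intro allI impI, elim conjE)
    fix p l assume p: "\<forall>n. p n \<in> endograph u" and lim: "p \<longlonglongrightarrow> l"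
    obtain x t where l: "l = (x, t)" by fastforce
    have limx: "(\<lambda>n. fst (p n)) \<longlonglongrightarrow> x" and limt: "(\<lambda>n. snd (p n)) \<longlonglongrightarrow> t"
      using tendsto_fst[OF lim] tendsto_snd[OF lim] l by auto
    have pn: "0 \<le> snd (p n) \<and> snd (p n) \<le> u (fst (p n))" for n
      using p endograph_iff[OF assms] by (metis prod.collapse)
    have "t \<le> c" if "u x < c" for c
    proof -
      have "\<forall>\<^sub>F y in nhds x. u y < c" using usc that by (auto simp: upper_semicontinuous_def)
      then have "\<forall>\<^sub>F n in sequentially. u (fst (p n)) < c"
        using limx eventually_compose_filterlim by blast
      then have "\<forall>\<^sub>F n in sequentially. snd (p n) \<le> c"
        by (rule eventually_mono) (use pn in \<open>meson less_imp_le order_trans\<close>)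
      then show ?thesis using limt tendsto_upperbound by fastforce
    qed
    then have "t \<le> u x" by (meson dense_ge)
    moreover have "0 \<le> t" using limt pn by (simp add: LIMSEQ_le_const)
    ultimately show "l \<in> endograph u" using l endograph_iff[OF assms] by blast
  qed
next
  assume cl: "closed (endograph u)"
  show "upper_semicontinuous u"
    unfolding upper_semicontinuous_def
  proof (intro allI impI)
    fix x c assume c: "u x < c"
    show "\<forall>\<^sub>F y in nhds x. u y < c"
    proof (cases "c \<le> 1")
      case True
      have "0 \<le> u x" using assms by (simp add: fuzzy_set_def)
      then have "open (- {y. c \<le> u y})"
        using closed_level[OF cl] True c by (simp add: open_Compl)
      then have "\<forall>\<^sub>F y in nhds x. y \<in> - {y. c \<le> u y}"
        using c by (intro eventually_nhds_in_open) auto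
      then show ?thesis by (simp add: not_le)
    next
      case False
      have "u y \<le> 1" for y using assms by (simp add: fuzzy_set_def)
      with False have "\<forall>y. u y < c" by (meson le_less_trans not_le)
      then show ?thesis by (intro always_eventually)
    qed
  qed
qed

text \<open>The fuzzy set with a given endograph takes at \<open>x\<close> the largest height above \<open>x\<close>; closedness
  is what makes this supremum a maximum.\<close>

lemma endograph_of_closed_hypograph:
  fixes E :: "((real ^ 'm) \<times> real) set"
  assumes cl: "closed E" and bnd: "\<And>x t. (x, t) \<in> E \<Longrightarrow> 0 \<le> t \<and> t \<le> 1"
    and floor: "\<And>x. (x, 0) \<in> E"
    and down: "\<And>x s t. (x, t) \<in> E \<Longrightarrow> 0 \<le> s \<Longrightarrow> s \<le> t \<Longrightarrow> (x, s) \<in> E"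
  obtains u where "fuzzy_set u" "endograph u = E"
proof
  define u where "u x = Sup {t. (x, t) \<in> E}" for x
  have bdd: "bdd_above {t. (x, t) \<in> E}" for x using bnd by (meson bdd_aboveI mem_Collect_eq)
  have "closed ((\<lambda>t. (x, t)) -` E)" for x by (intro closed_vimage cl continuous_intros)
  then have "closed {t. (x, t) \<in> E}" for x by (simp add: vimage_def)
  then have top: "(x, u x) \<in> E" for x
    using closed_contains_Sup[of "{t. (x, t) \<in> E}"] floor bdd u_def by auto
  have le: "t \<le> u x" if "(x, t) \<in> E" for x t
    unfolding u_def using bdd that by (simp add: cSup_upper)
  show fz: "fuzzy_set u" using top bnd by (auto simp: fuzzy_set_def)
  have "(x, t) \<in> endograph u \<longleftrightarrow> (x, t) \<in> E" for x t
    using endograph_iff[OF fz, of x t] bnd le top down by blast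
  then show "endograph u = E" by auto
qed

lemma endograph_metric_eq_0_iff:
  fixes u v :: "real ^ 'm \<Rightarrow> real"
  assumes "fuzzy_set u" "fuzzy_set v" "upper_semicontinuous u" "upper_semicontinuous v"
  shows "endograph_metric u v = 0 \<longleftrightarrow> u = v"
proof
  assume z: "endograph_metric u v = 0"
  have le: "x y \<le> z y" if "fuzzy_set x" "fuzzy_set z" "upper_semicontinuous z"
    "endograph_metric x z = 0" for x z :: "real ^ 'm \<Rightarrow> real" and y
  proof -
    have y: "(y, x y) \<in> endograph x" using that(1) by (auto simp: endograph_def fuzzy_set_def)
    have "\<exists>q\<in>endograph z. dist q (y, x y) < e" if "e > 0" for e
      using endograph_metric_lessD[OF \<open>fuzzy_set x\<close> \<open>fuzzy_set z\<close> _ y, of e] that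
        \<open>endograph_metric x z = 0\<close> by (metis dist_commute)
    then have "(y, x y) \<in> closure (endograph z)" by (simp add: closure_approachable)
    then have "(y, x y) \<in> endograph z"
      using that(2,3) upper_semicontinuous_iff_closed_endograph closure_closed by blast
    then show ?thesis using endograph_iff that(2) by blast
  qed
  show "u = v"
    using le[of u v] le[of v u] z assms endograph_metric_commute[of u v] by (intro ext antisym) auto
next
  assume "u = v"
  then have "endograph_metric u v \<le> 0" by (intro endograph_metric_leI) auto
  then show "endograph_metric u v = 0" using endograph_metric_nonneg[of u v] by simp
qed

section \<open>Limits of noncompact fuzzy numbers\<close>

lemma noncompact_fuzzy_numbersD:
  assumes "u \<in> noncompact_fuzzy_numbers"
  shows "fuzzy_set u" "upper_semicontinuous u" "\<exists>x. u x = 1" "fuzzy_convex u"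
    and "\<And>\<alpha>. 0 < \<alpha> \<Longrightarrow> \<alpha> \<le> 1 \<Longrightarrow> bounded {x. \<alpha> \<le> u x}"
proof -
  show "bounded {x. \<alpha> \<le> u x}" if "0 < \<alpha>" "\<alpha> \<le> 1" for \<alpha>
  proof -
    have "bounded (level_set u \<alpha>)" using assms that by (simp add: noncompact_fuzzy_numbers_def)
    then show ?thesis using that by (simp add: level_set_def)
  qed
qed (use assms in \<open>auto simp: noncompact_fuzzy_numbers_def normal_fuzzy_def\<close>)

text \<open>An approximation by a noncompact fuzzy number at distance below \<open>\<alpha>/2\<close> moves a point of
  height at least \<open>\<alpha>\<close> to one of height at least \<open>\<alpha>/2\<close>, and those points form a bounded set.\<close>

lemma bounded_level_of_approximation:
  fixes u :: "real ^ 'm \<Rightarrow> real"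
  assumes fz: "fuzzy_set u" and "0 < \<alpha>" "\<alpha> \<le> 1"
    and v: "v \<in> noncompact_fuzzy_numbers" "endograph_metric u v < \<alpha>/2"
  shows "bounded {x. \<alpha> \<le> u x}"
proof -
  note fv = noncompact_fuzzy_numbersD(1)[OF v(1)]
  have "bounded {x. \<alpha>/2 \<le> v x}"
    using noncompact_fuzzy_numbersD(5)[OF v(1), of "\<alpha>/2"] assms(2,3) by simp
  then obtain B where B: "\<And>x. \<alpha>/2 \<le> v x \<Longrightarrow> norm x \<le> B" by (auto simp: bounded_iff)
  have "norm x \<le> B + \<alpha>/2" if "\<alpha> \<le> u x" for x
  proof -
    have "(x, \<alpha>) \<in> endograph u" using that endograph_iff[OF fz] assms(2) by simp
    then obtain y s where ys: "(y, s) \<in> endograph v" "dist (x, \<alpha>) (y, s) < \<alpha>/2"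
      using endograph_metric_lessD[OF fz fv v(2)] by (metis surj_pair)
    then have "dist x y < \<alpha>/2" "dist \<alpha> s < \<alpha>/2"
      using dist_fst_le[of "(x, \<alpha>)" "(y, s)"] dist_snd_le[of "(x, \<alpha>)" "(y, s)"] by auto
    moreover have "s \<le> v y" using ys(1) endograph_iff[OF fv] by blast
    ultimately have "dist x y < \<alpha>/2" "\<alpha>/2 \<le> v y" unfolding dist_real_def by linarith+
    then show ?thesis
      using B[of y] norm_triangle_ineq2[of x y] by (simp add: dist_norm)
  qed
  then show ?thesis by (auto simp: bounded_iff)
qed

text \<open>Normality of the approximations gives points of height at least \<open>1 - e\<close> for every \<open>e\<close>. For
  \<open>e \<le> 1/2\<close> they lie in a compact level set, so they accumulate at a point as \<open>e\<close> tends to 0; this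
  point has height 1 because the endograph is closed.\<close>

lemma normal_of_approximation:
  fixes u :: "real ^ 'm \<Rightarrow> real"
  assumes fz: "fuzzy_set u" and cl: "closed (endograph u)"
    and app: "\<And>e. 0 < e \<Longrightarrow> \<exists>v\<in>noncompact_fuzzy_numbers. endograph_metric u v < e"
  shows "\<exists>x. u x = 1"
proof -
  have near: "\<exists>y. 1 - e \<le> u y" if e: "0 < e" for e
  proof -
    obtain v where v: "v \<in> noncompact_fuzzy_numbers" "endograph_metric v u < e"
      using app[OF e] endograph_metric_commute by metis
    note fv = noncompact_fuzzy_numbersD(1)[OF v(1)]
    obtain x where "v x = 1" using noncompact_fuzzy_numbersD(3)[OF v(1)] by blast
    then have "(x, 1) \<in> endograph v" using endograph_iff[OF fv] by simp
    then obtain y s where ys: "(y, s) \<in> endograph u" "dist (x, 1) (y, s) < e"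
      using endograph_metric_lessD[OF fv fz v(2)] by (metis surj_pair)
    then have "dist 1 s < e" using dist_snd_le[of "(x, 1)" "(y, s)"] by auto
    moreover have "s \<le> u y" using ys(1) endograph_iff[OF fz] by blast
    ultimately have "1 - e \<le> u y" unfolding dist_real_def by linarith
    then show ?thesis by blast
  qed
  obtain v where "v \<in> noncompact_fuzzy_numbers" "endograph_metric u v < (1/2)/2"
    using app[of "(1/2)/2"] by auto
  then have "bounded {x. 1/2 \<le> u x}"
    by (intro bounded_level_of_approximation[OF fz]) auto
  then have comp: "compact {x. 1/2 \<le> u x}"
    using closed_level[OF cl, of "1/2"] by (simp add: compact_eq_bounded_closed)
  \<comment> \<open>Heights at least \<open>1 - 1/(n + 2)\<close> are at least \<open>1/2\<close>, so all chosen points lie in this compact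
    set.\<close>
  have "\<forall>n. \<exists>y. 1 - inverse (real n + 2) \<le> u y" using near by (simp add: add_nonneg_pos)
  then obtain y where y: "\<And>n. 1 - inverse (real n + 2) \<le> u (y n)" by metis
  have "y n \<in> {x. 1/2 \<le> u x}" for n
  proof -
    have "inverse (real n + 2) \<le> 1/2" by (simp add: field_simps)
    then show ?thesis using y[of n] by simp
  qed
  then obtain l r where r: "strict_mono r" "(y \<circ> r) \<longlonglongrightarrow> l"
    using comp unfolding compact_def by metis
  have "(\<lambda>n. inverse (real n + 2)) \<longlonglongrightarrow> 0"
    using LIMSEQ_Suc[OF LIMSEQ_inverse_real_of_nat] by (simp add: add.commute)
  then have "(\<lambda>n. 1 - inverse (real n + 2)) \<longlonglongrightarrow> 1"
    using tendsto_diff[OF tendsto_const[of 1]] by fastforce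
  then have "((\<lambda>n. 1 - inverse (real n + 2)) \<circ> r) \<longlonglongrightarrow> 1"
    using LIMSEQ_subseq_LIMSEQ r(1) by fastforce
  then have lim: "(\<lambda>n. ((y \<circ> r) n, 1 - inverse (real (r n) + 2))) \<longlonglongrightarrow> (l, 1)"
    using r(2) by (intro tendsto_Pair) (auto simp: o_def)
  have mem: "((y \<circ> r) n, 1 - inverse (real (r n) + 2)) \<in> endograph u" for n
    using y[of "r n"] endograph_iff[OF fz] by (simp add: field_simps)
  have "(l, 1) \<in> endograph u" by (rule closed_sequentially[OF cl mem lim])
  then have "1 \<le> u l" using endograph_iff[OF fz] by blast
  then show ?thesis using fz by (auto simp: fuzzy_set_def intro: antisym)
qed

lemma dist_Pair_le: "dist (a, b) (c, d) \<le> dist a c + dist b d"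
  by (simp add: dist_prod_def sqrt_sum_squares_le_sum)

text \<open>Two points of height at least \<open>t\<close> have companions of height at least \<open>t - d\<close> in a convex
  approximation, so the segment between the companions stays at height at least \<open>t - d\<close> and within \<open>d\<close>
  of the given segment. As \<open>d\<close> shrinks, closedness of the endograph gives height \<open>t\<close> itself.\<close>

lemma fuzzy_convex_of_approximation:
  fixes u :: "real ^ 'm \<Rightarrow> real"
  assumes fz: "fuzzy_set u" and cl: "closed (endograph u)"
    and app: "\<And>e. 0 < e \<Longrightarrow> \<exists>v\<in>noncompact_fuzzy_numbers. endograph_metric u v < e"
  shows "fuzzy_convex u"
  unfolding fuzzy_convex_def
proof (intro allI ballI)
  fix x y :: "real ^ 'm" and l :: real assume l: "l \<in> {0..1}"
  let ?z = "l *\<^sub>R x + (1 - l) *\<^sub>R y" and ?t = "min (u x) (u y)"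
  have t0: "0 \<le> ?t" using fz by (simp add: fuzzy_set_def)
  have "\<exists>q\<in>endograph u. dist q (?z, ?t) < e" if e: "0 < e" for e
  proof -
    \<comment> \<open>Three errors are added up: the shift of \<open>?z\<close>, the drop below \<open>?t\<close>, and the way back to \<open>u\<close>.\<close>
    define d where "d = e/3"
    have d: "0 < d" using e by (simp add: d_def)
    obtain v where v: "v \<in> noncompact_fuzzy_numbers" and uv: "endograph_metric u v < d"
      using app d by blast
    have vu: "endograph_metric v u < d" using uv by (simp add: endograph_metric_commute)
    note fv = noncompact_fuzzy_numbersD(1)[OF v]
    have near: "\<exists>b. dist a b < d \<and> ?t - d \<le> v b" if "?t \<le> u a" for a
    proof -
      have "(a, ?t) \<in> endograph u" using that t0 endograph_iff[OF fz] by blast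
      then obtain b s where bs: "(b, s) \<in> endograph v" "dist (a, ?t) (b, s) < d"
        using endograph_metric_lessD[OF fz fv uv] by (metis surj_pair)
      then have "dist a b < d" "dist ?t s < d"
        using dist_fst_le[of "(a, ?t)" "(b, s)"] dist_snd_le[of "(a, ?t)" "(b, s)"] by auto
      then show ?thesis using bs(1) endograph_iff[OF fv] by (force simp: dist_real_def)
    qed
    obtain x' where x': "dist x x' < d" "?t - d \<le> v x'" using near[of x] by auto
    obtain y' where y': "dist y y' < d" "?t - d \<le> v y'" using near[of y] by auto
    let ?z' = "l *\<^sub>R x' + (1 - l) *\<^sub>R y'" and ?s = "max 0 (?t - d)"
    have "min (v x') (v y') \<le> v ?z'"
      using noncompact_fuzzy_numbersD(4)[OF v] l by (simp add: fuzzy_convex_def)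
    then have "(?z', ?s) \<in> endograph v"
      using x'(2) y'(2) fv endograph_iff[OF fv] by (auto simp: fuzzy_set_def)
    then obtain q where q: "q \<in> endograph u" "dist (?z', ?s) q < d"
      using endograph_metric_lessD[OF fv fz vu] by blast
    have "?z - ?z' = l *\<^sub>R (x - x') + (1 - l) *\<^sub>R (y - y')" by (simp add: algebra_simps)
    then have "dist ?z ?z' \<le> l * dist x x' + (1 - l) * dist y y'"
      using norm_triangle_ineq[of "l *\<^sub>R (x - x')" "(1 - l) *\<^sub>R (y - y')"] l
      by (simp add: dist_norm)
    also have "\<dots> \<le> d" using x'(1) y'(1) l by (intro convex_bound_le) auto
    finally have "dist ?z ?z' \<le> d" .
    moreover have "dist t (max 0 (t - d)) \<le> d" if "0 \<le> t" for t :: real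
      using that d by (auto simp: dist_real_def max_def)
    from this[OF t0] have "dist ?t ?s \<le> d" .
    ultimately have "dist (?z, ?t) (?z', ?s) \<le> d + d"
      using dist_Pair_le[of ?z ?t ?z' ?s] by linarith
    then have "dist (?z, ?t) q < e"
      using q(2) dist_triangle[of "(?z, ?t)" q "(?z', ?s)"] unfolding d_def by linarith
    then show ?thesis using q(1) by (metis dist_commute)
  qed
  then have "(?z, ?t) \<in> closure (endograph u)" by (simp add: closure_approachable)
  then show "?t \<le> u ?z" using cl endograph_iff[OF fz] by simp
qed

lemma limit_in_noncompact_fuzzy_numbers:
  fixes u :: "real ^ 'm \<Rightarrow> real"
  assumes fz: "fuzzy_set u" and cl: "closed (endograph u)"
    and app: "\<And>e. 0 < e \<Longrightarrow> \<exists>v\<in>noncompact_fuzzy_numbers. endograph_metric u v < e"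
  shows "u \<in> noncompact_fuzzy_numbers"
proof -
  have "bounded (level_set u \<alpha>)" if "\<alpha> \<in> {0<..1}" for \<alpha>
    using bounded_level_of_approximation[OF fz, of \<alpha>] app[of "\<alpha>/2"] that
    by (auto simp: level_set_def)
  then show ?thesis
    using normal_of_approximation[OF assms] fuzzy_convex_of_approximation[OF assms]
      upper_semicontinuous_iff_closed_endograph[OF fz] fz cl
    by (simp add: noncompact_fuzzy_numbers_def normal_fuzzy_def)
qed

section \<open>Completeness\<close>

text \<open>The lower Kuratowski limit of the sequence \<open>A\<close>.\<close>

definition lower_limit :: "(nat \<Rightarrow> 'a::metric_space set) \<Rightarrow> 'a set" where
  "lower_limit A = {q. \<forall>e>0. \<forall>\<^sub>F n in sequentially. \<exists>p\<in>A n. dist p q < e}"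

lemma lower_limitD:
  "q \<in> lower_limit A \<Longrightarrow> 0 < e \<Longrightarrow> \<forall>\<^sub>F n in sequentially. \<exists>p\<in>A n. dist p q < e"
  by (simp add: lower_limit_def)

lemma closed_lower_limit: "closed (lower_limit A)"
proof -
  have "q \<in> lower_limit A" if q: "q \<in> closure (lower_limit A)" for q
    unfolding lower_limit_def
  proof (intro CollectI allI impI)
    fix e :: real assume "0 < e"
    then obtain r where r: "r \<in> lower_limit A" "dist r q < e/2"
      using q by (meson closure_approachable half_gt_zero)
    have "\<forall>\<^sub>F n in sequentially. \<exists>p\<in>A n. dist p r < e/2"
      using \<open>0 < e\<close> by (intro lower_limitD[OF r(1)]) simp
    then show "\<forall>\<^sub>F n in sequentially. \<exists>p\<in>A n. dist p q < e"
      by (rule eventually_mono) (use r(2) dist_triangle_half_r dist_commute in metis)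
  qed
  then show ?thesis by (metis closure_subset closure_eq subsetI subset_antisym)
qed

text \<open>Lowering a point \<open>(x, t)\<close> of the limit to height \<open>s\<close> is done by truncating at \<open>s\<close> the points
  that approach it; truncation does not increase the distance.\<close>

lemma lower_limit_endograph:
  fixes \<sigma> :: "nat \<Rightarrow> real ^ 'm \<Rightarrow> real"
  assumes fz: "\<And>n. fuzzy_set (\<sigma> n)"
  obtains u where "fuzzy_set u" "endograph u = lower_limit (\<lambda>n. endograph (\<sigma> n))"
proof -
  let ?E = "lower_limit (\<lambda>n. endograph (\<sigma> n))"
  have floor: "(x, 0) \<in> ?E" for x
  proof -
    have "(x, 0) \<in> endograph (\<sigma> n)" for n
      using fz[of n] endograph_iff[OF fz] by (simp add: fuzzy_set_def)
    then show ?thesis unfolding lower_limit_def by (force intro: always_eventually)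
  qed
  have bnd: "0 \<le> t \<and> t \<le> 1" if "(x, t) \<in> ?E" for x t
  proof -
    have "-e < t \<and> t < 1 + e" if "0 < e" for e
    proof -
      have "\<forall>\<^sub>F n in sequentially. \<exists>p\<in>endograph (\<sigma> n). dist p (x, t) < e"
        using lower_limitD \<open>(x, t) \<in> ?E\<close> that by blast
      from eventually_happens'[OF sequentially_bot this]
      obtain n p where "p \<in> endograph (\<sigma> n)" "dist p (x, t) < e" by blast
      moreover obtain y s where "p = (y, s)" by fastforce
      ultimately have "(y, s) \<in> endograph (\<sigma> n)" "dist (y, s) (x, t) < e" by simp_all
      then have "0 \<le> s" "s \<le> 1" "dist s t < e"
        using dist_snd_le[of "(y, s)" "(x, t)"] by (auto simp: endograph_def)
      then show ?thesis by (auto simp: dist_real_def)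
    qed
    from this[of "-t"] this[of "t - 1"] show ?thesis by force
  qed
  have down: "(x, s) \<in> ?E" if t: "(x, t) \<in> ?E" and s: "0 \<le> s" "s \<le> t" for x s t
    unfolding lower_limit_def
  proof (intro CollectI allI impI)
    fix e :: real assume "0 < e"
    then have "\<forall>\<^sub>F n in sequentially. \<exists>p\<in>endograph (\<sigma> n). dist p (x, t) < e"
      using lower_limitD[OF t] by blast
    then show "\<forall>\<^sub>F n in sequentially. \<exists>p\<in>endograph (\<sigma> n). dist p (x, s) < e"
    proof (rule eventually_mono)
      fix n assume "\<exists>p\<in>endograph (\<sigma> n). dist p (x, t) < e"
      then obtain y r where p: "(y, r) \<in> endograph (\<sigma> n)" "dist (y, r) (x, t) < e"
        by (metis surj_pair)
      have "dist (min r s) s \<le> dist r t" using s by (auto simp: dist_real_def)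
      then have "dist (y, min r s) (x, s) \<le> dist (y, r) (x, t)"
        by (simp add: dist_prod_def power_mono)
      moreover have "(y, min r s) \<in> endograph (\<sigma> n)"
        using p(1) s(1) endograph_iff[OF fz] by (simp add: min_le_iff_disj)
      ultimately show "\<exists>p\<in>endograph (\<sigma> n). dist p (x, s) < e" using p(2) by force
    qed
  qed
  show ?thesis
    by (rule endograph_of_closed_hypograph[of ?E])
      (use closed_lower_limit bnd floor down that in blast)+
qed

text \<open>The nontrivial direction starts from a point \<open>p\<close> of a late endograph. The Cauchy property gives
  a companion \<open>f k\<close> of \<open>p\<close> in each later endograph, and by compactness a subsequence of \<open>f\<close> converges
  to some \<open>q\<close> near \<open>p\<close>. That only shows that \<open>q\<close> is approached along a subsequence of the
  endographs; a second use of the Cauchy property extends this to all of them.\<close>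

lemma lower_limit_of_Cauchy:
  fixes \<sigma> :: "nat \<Rightarrow> real ^ 'm \<Rightarrow> real"
  assumes fz: "\<And>n. fuzzy_set (\<sigma> n)"
    and Cauchy: "\<And>e. 0 < e \<Longrightarrow> \<exists>N. \<forall>m\<ge>N. \<forall>n\<ge>N. endograph_metric (\<sigma> m) (\<sigma> n) < e"
    and u: "endograph u = lower_limit (\<lambda>n. endograph (\<sigma> n))"
    and "0 < e"
  shows "\<forall>\<^sub>F n in sequentially. endograph_metric (\<sigma> n) u < e"
proof -
  define d where "d = e/2"
  have d: "0 < d" using \<open>0 < e\<close> by (simp add: d_def)
  obtain N where N: "\<And>m n. N \<le> m \<Longrightarrow> N \<le> n \<Longrightarrow> endograph_metric (\<sigma> m) (\<sigma> n) < d/2"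
    using Cauchy[of "d/2"] d by auto
  have "endograph_metric (\<sigma> n) u \<le> d" if n: "N \<le> n" for n
  proof (rule endograph_metric_leI)
    show "0 \<le> d" using d by simp
  next
    fix q assume "q \<in> endograph u"
    then have "q \<in> lower_limit (\<lambda>n. endograph (\<sigma> n))" using u by simp
    then have "\<forall>\<^sub>F k in sequentially. \<exists>p\<in>endograph (\<sigma> k). dist p q < d/2"
      by (rule lower_limitD) (use d in simp)
    then obtain k p where k: "N \<le> k" and p: "p \<in> endograph (\<sigma> k)" "dist p q < d/2"
      unfolding eventually_sequentially by (metis nle_le)
    obtain p' where "p' \<in> endograph (\<sigma> n)" "dist p p' < d/2"
      using endograph_metric_lessD[OF fz fz N[OF k n] p(1)] by blast
    then show "\<exists>p\<in>endograph (\<sigma> n). dist q p \<le> d"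
      using p(2) dist_triangle_half_r[of p q d p'] by force
  next
    fix p assume p: "p \<in> endograph (\<sigma> n)"
    have "\<exists>q\<in>endograph (\<sigma> (N + k)). dist p q < d/2" for k
      using endograph_metric_lessD[OF fz fz N p, of "N + k"] n by simp
    then obtain f where f: "\<And>k. f k \<in> endograph (\<sigma> (N + k))" "\<And>k. dist p (f k) < d/2"
      by metis
    have "f k \<in> cball p d" for k using f(2)[of k] d by simp
    then obtain q r where q: "q \<in> cball p d" and r: "strict_mono r" "(f \<circ> r) \<longlonglongrightarrow> q"
      using compact_cball[of p d] unfolding compact_def by metis
    have "q \<in> lower_limit (\<lambda>n. endograph (\<sigma> n))"
      unfolding lower_limit_def
    proof (intro CollectI allI impI)
      fix c :: real assume c: "0 < c"
      obtain K where K: "\<And>m n. K \<le> m \<Longrightarrow> K \<le> n \<Longrightarrow> endograph_metric (\<sigma> m) (\<sigma> n) < c/2"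
        using Cauchy[of "c/2"] c by auto
      have "\<forall>\<^sub>F j in sequentially. dist ((f \<circ> r) j) q < c/2"
        by (rule tendstoD[OF r(2)]) (use c in simp)
      then have "\<forall>\<^sub>F j in sequentially. dist (f (r j)) q < c/2 \<and> K \<le> j"
        using eventually_ge_at_top[of K] by eventually_elim simp
      from eventually_happens'[OF sequentially_bot this]
      obtain j where j: "dist (f (r j)) q < c/2" "K \<le> j" by blast
      have Kj: "K \<le> N + r j" using j(2) seq_suble[OF r(1), of j] by simp
      have "\<exists>p\<in>endograph (\<sigma> k). dist p q < c" if k: "K \<le> k" for k
      proof -
        obtain p' where p': "p' \<in> endograph (\<sigma> k)" "dist (f (r j)) p' < c/2"
          using endograph_metric_lessD[OF fz fz K[OF Kj k] f(1)] by blast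
        have "dist p' q < c" using dist_triangle_half_r[OF p'(2) j(1)] .
        then show ?thesis using p'(1) by blast
      qed
      then show "\<forall>\<^sub>F k in sequentially. \<exists>p\<in>endograph (\<sigma> k). dist p q < c"
        by (rule eventually_sequentiallyI)
    qed
    then show "\<exists>q\<in>endograph u. dist p q \<le> d" using q u by auto
  qed
  moreover have "d < e" using \<open>0 < e\<close> by (simp add: d_def)
  ultimately show ?thesis by (intro eventually_sequentiallyI[of N]) force
qed

lemma Metric_space_noncompact_fuzzy_numbers:
  "Metric_space (noncompact_fuzzy_numbers :: (real ^ 'm \<Rightarrow> real) set) endograph_metric"
proof
  fix u v w :: "real ^ 'm \<Rightarrow> real"
  show "0 \<le> endograph_metric u v" by (rule endograph_metric_nonneg)
  show "endograph_metric u v = endograph_metric v u" by (rule endograph_metric_commute)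
  assume uv: "u \<in> noncompact_fuzzy_numbers" "v \<in> noncompact_fuzzy_numbers"
  then show "endograph_metric u v = 0 \<longleftrightarrow> u = v"
    by (intro endograph_metric_eq_0_iff noncompact_fuzzy_numbersD)
  assume "w \<in> noncompact_fuzzy_numbers"
  with uv show "endograph_metric u w \<le> endograph_metric u v + endograph_metric v w"
    by (intro endograph_metric_triangle noncompact_fuzzy_numbersD)
qed

lemma mcomplete_noncompact_fuzzy_numbers:
  "Metric_space.mcomplete (noncompact_fuzzy_numbers :: (real ^ 'm \<Rightarrow> real) set) endograph_metric"
proof -
  interpret Metric_space "noncompact_fuzzy_numbers :: (real ^ 'm \<Rightarrow> real) set" endograph_metric
    by (rule Metric_space_noncompact_fuzzy_numbers)
  show ?thesis
    unfolding mcomplete_def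
  proof (intro allI impI)
    fix \<sigma> :: "nat \<Rightarrow> real ^ 'm \<Rightarrow> real" assume C: "MCauchy \<sigma>"
    have \<sigma>: "\<sigma> n \<in> noncompact_fuzzy_numbers" for n using C by (auto simp: MCauchy_def)
    note fz = noncompact_fuzzy_numbersD(1)[OF \<sigma>]
    have "\<forall>e>0. \<exists>N. \<forall>m n. N \<le> m \<longrightarrow> N \<le> n \<longrightarrow> endograph_metric (\<sigma> m) (\<sigma> n) < e"
      using C unfolding MCauchy_def by (rule conjunct2)
    then have Cauchy: "\<exists>N. \<forall>m\<ge>N. \<forall>n\<ge>N. endograph_metric (\<sigma> m) (\<sigma> n) < e"
      if "0 < e" for e
      using that by simp
    obtain u where u: "fuzzy_set u" "endograph u = lower_limit (\<lambda>n. endograph (\<sigma> n))"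
      by (rule lower_limit_endograph[OF fz])
    have lim: "\<forall>\<^sub>F n in sequentially. endograph_metric (\<sigma> n) u < e" if "0 < e" for e
      by (rule lower_limit_of_Cauchy[OF fz Cauchy u(2) that])
    have "u \<in> noncompact_fuzzy_numbers"
    proof (rule limit_in_noncompact_fuzzy_numbers[OF u(1)])
      show "closed (endograph u)" unfolding u(2) by (rule closed_lower_limit)
      fix e :: real assume "0 < e"
      from eventually_happens'[OF sequentially_bot lim[OF this]]
      obtain n where "endograph_metric (\<sigma> n) u < e" by blast
      then have "endograph_metric u (\<sigma> n) < e" by (simp add: endograph_metric_commute)
      then show "\<exists>v\<in>noncompact_fuzzy_numbers. endograph_metric u v < e" using \<sigma> by blast
    qed
    then have "limitin mtopology \<sigma> u sequentially"
      using lim \<sigma> by (simp add: limitin_metric)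
    then show "\<exists>x. limitin mtopology \<sigma> x sequentially" by blast
  qed
qed

section \<open>Density of the fuzzy numbers\<close>

lemma fuzzy_numbers_subset:
  "(fuzzy_numbers :: (real ^ 'm \<Rightarrow> real) set) \<subseteq> noncompact_fuzzy_numbers"
proof -
  have "level_set u \<alpha> \<subseteq> level_set u 0" if "\<alpha> \<in> {0<..1}" for u :: "real ^ 'm \<Rightarrow> real" and \<alpha>
    using that closure_subset[of "{x. 0 < u x}"] by (fastforce simp: level_set_def)
  then have "bounded (level_set u \<alpha>)" if "bounded (level_set u 0)" "\<alpha> \<in> {0<..1}"
    for u :: "real ^ 'm \<Rightarrow> real" and \<alpha>
    using that bounded_subset[of "level_set u 0"] by simp
  then show ?thesis by (auto simp: fuzzy_numbers_def noncompact_fuzzy_numbers_def)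
qed

definition cut_below :: "real \<Rightarrow> (real ^ 'm \<Rightarrow> real) \<Rightarrow> real ^ 'm \<Rightarrow> real" where
  "cut_below e u x = (if e \<le> u x then u x else 0)"

lemma cut_below_in_fuzzy_numbers:
  fixes u :: "real ^ 'm \<Rightarrow> real"
  assumes u: "u \<in> noncompact_fuzzy_numbers" and e: "0 < e" "e \<le> 1"
  shows "cut_below e u \<in> fuzzy_numbers"
proof -
  let ?v = "cut_below e u"
  note fz = noncompact_fuzzy_numbersD(1)[OF u]
  have fv: "fuzzy_set ?v" using fz by (simp add: fuzzy_set_def cut_below_def)
  have cl: "closed (endograph u)"
    using upper_semicontinuous_iff_closed_endograph[OF fz] noncompact_fuzzy_numbersD(2)[OF u]
    by blast
  have "endograph ?v = (endograph u \<inter> {x. e \<le> u x} \<times> UNIV) \<union> UNIV \<times> {0}"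
    using endograph_iff[OF fz] endograph_iff[OF fv] fz
    by (auto simp: cut_below_def fuzzy_set_def split: if_splits)
  then have "closed (endograph ?v)"
    using cl closed_level[OF cl, of e] e by (simp add: closed_Un closed_Int closed_Times)
  then have usc: "upper_semicontinuous ?v"
    using upper_semicontinuous_iff_closed_endograph[OF fv] by blast
  have normal: "normal_fuzzy ?v"
    using noncompact_fuzzy_numbersD(3)[OF u] e by (auto simp: normal_fuzzy_def cut_below_def)
  have "min (?v x) (?v y) \<le> ?v (l *\<^sub>R x + (1 - l) *\<^sub>R y)" if "l \<in> {0..1}" for x y l
  proof (cases "e \<le> u x \<and> e \<le> u y")
    case True
    moreover have "min (u x) (u y) \<le> u (l *\<^sub>R x + (1 - l) *\<^sub>R y)"
      using noncompact_fuzzy_numbersD(4)[OF u] that by (simp add: fuzzy_convex_def)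
    ultimately show ?thesis by (auto simp: cut_below_def)
  next
    case False
    then have "min (?v x) (?v y) \<le> 0" by (auto simp: cut_below_def)
    then show ?thesis using fv unfolding fuzzy_set_def by (meson order_trans)
  qed
  then have convex: "fuzzy_convex ?v" by (simp add: fuzzy_convex_def)
  have "{x. 0 < ?v x} \<subseteq> {x. e \<le> u x}" by (auto simp: cut_below_def)
  then have "bounded (level_set ?v 0)"
    using noncompact_fuzzy_numbersD(5)[OF u e] bounded_subset
    by (auto simp: level_set_def)
  then show ?thesis using fv usc normal convex by (simp add: fuzzy_numbers_def)
qed

lemma endograph_metric_cut_below_le:
  fixes u :: "real ^ 'm \<Rightarrow> real"
  assumes fz: "fuzzy_set u" and e: "0 < e"
  shows "endograph_metric u (cut_below e u) \<le> e"
proof (rule endograph_metric_leI)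
  show "0 \<le> e" using e by simp
  show "\<exists>q\<in>endograph u. dist p q \<le> e" if "p \<in> endograph (cut_below e u)" for p
  proof -
    have "cut_below e u x \<le> u x" for x using fz by (simp add: cut_below_def fuzzy_set_def)
    then have "p \<in> endograph u" using that by (auto simp: endograph_def intro: order_trans)
    then show ?thesis using e by (intro bexI[of _ p]) auto
  qed
  show "\<exists>q\<in>endograph (cut_below e u). dist p q \<le> e" if "p \<in> endograph u" for p
  proof -
    obtain x t where p: "p = (x, t)" by fastforce
    then have t: "0 \<le> t" "t \<le> 1" "t \<le> u x" using that by (auto simp: endograph_def)
    show ?thesis
    proof (cases "e \<le> u x")
      case True
      then have "p \<in> endograph (cut_below e u)"
        using p t by (simp add: endograph_def cut_below_def)
      then show ?thesis using e by (intro bexI[of _ p]) auto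
    next
      case False
      \<comment> \<open>Here the whole column above \<open>x\<close> is cut off, and \<open>p\<close> drops to the floor.\<close>
      then have "(x, 0) \<in> endograph (cut_below e u)" by (simp add: endograph_def cut_below_def)
      moreover have "dist p (x, 0) \<le> e"
        using p t False by (simp add: dist_prod_def)
      ultimately show ?thesis by blast
    qed
  qed
qed

lemma closure_of_fuzzy_numbers:
  "Metric_space.mtopology (noncompact_fuzzy_numbers :: (real ^ 'm \<Rightarrow> real) set) endograph_metric
    closure_of fuzzy_numbers = noncompact_fuzzy_numbers"
proof -
  interpret Metric_space "noncompact_fuzzy_numbers :: (real ^ 'm \<Rightarrow> real) set" endograph_metric
    by (rule Metric_space_noncompact_fuzzy_numbers)
  have "\<exists>v\<in>fuzzy_numbers. v \<in> mball u r"
    if u: "u \<in> noncompact_fuzzy_numbers" and r: "0 < r" for u :: "real ^ 'm \<Rightarrow> real" and r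
  proof -
    define e where "e = min 1 (r/2)"
    have e: "0 < e" "e \<le> 1" "e < r" using r by (auto simp: e_def)
    have "cut_below e u \<in> fuzzy_numbers" using cut_below_in_fuzzy_numbers u e by blast
    moreover have "endograph_metric u (cut_below e u) < r"
      using endograph_metric_cut_below_le[OF noncompact_fuzzy_numbersD(1)[OF u] e(1)] e(3) by simp
    ultimately show ?thesis using u fuzzy_numbers_subset by force
  qed
  then show ?thesis by (auto simp: metric_closure_of)
qed

theorem theorem9p15:
  shows "Metric_space (noncompact_fuzzy_numbers :: (real ^ 'm \<Rightarrow> real) set) endograph_metric \<and>
    Metric_space.mcomplete (noncompact_fuzzy_numbers :: (real ^ 'm \<Rightarrow> real) set) endograph_metric \<and>
    (fuzzy_numbers :: (real ^ 'm \<Rightarrow> real) set) \<subseteq> noncompact_fuzzy_numbers \<and>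
    Metric_space.mtopology (noncompact_fuzzy_numbers :: (real ^ 'm \<Rightarrow> real) set) endograph_metric
      closure_of fuzzy_numbers = noncompact_fuzzy_numbers"
  by (intro conjI Metric_space_noncompact_fuzzy_numbers mcomplete_noncompact_fuzzy_numbers
      fuzzy_numbers_subset closure_of_fuzzy_numbers)

end
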